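(* Assume that $\mathcal{E}_p$ is infinite-dimensional (i.e. $B_p$ is infinite-dimensional) and that the $m$-projection $\pi^{(m)}(q)$ exists for every $q\in\mathcal{E}_p$. Let $\varrho$ be any metric on $\mathcal{N}$ and define $\tilde d:\mathcal{E}_p\times\mathcal{E}_p\to[0,\infty)$ by $\tilde d(q_1,q_2)=\varrho(\pi^{(m)}(q_1),\pi^{(m)}(q_2))$. Then: (i) $\tilde d(q_1,q_2)\ge 0$ for all $q_1,q_2\in\mathcal{E}_p$. (ii) $\tilde d(q_1,q_2)=\tilde d(q_2,q_1)$ for all $q_1,q_2\in\mathcal{E}_p$. (iii) $\tilde d(q_1,q_3)\le\tilde d(q_1,q_2)+\tilde d(q_2,q_3)$ for all $q_1,q_2,q_3\in\mathcal{E}_p$. (iv) $\tilde d(q_1,q_2)=0$ if and only if $\mathbb{E}_{q_1}[u_j]=\mathbb{E}_{q_2}[u_j]$ for all $j=1,\ldots,d$. In particular, $\tilde d$ is a pseudo-metric on $\mathcal{E}_p$: it satisfies all metric axioms except that $\tilde d(q_1,q_2)=0$ does not imply $q_1=q_2$.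
   Context: Let $(X,\mathcal{X},\mu)$ be a $\sigma$-finite measure space and let $\mathcal{M}_\mu$ be the set of measurable $p:X\to\mathbb{R}$ with $p>0$ $\mu$-a.e. and $\int_X p\,d\mu=1$ (densities are identified when equal $\mu$-a.e.). For $p\in\mathcal{M}_\mu$ write $\mathbb{E}_p[u]=\int_X u\,p\,d\mu$. Fix a reference density $p\in\mathcal{M}_\mu$. Let $B_p$ be the Banach space of ($\mu$-a.e. classes of) measurable $u:X\to\mathbb{R}$ such that $\mathbb{E}_p[\cosh(\alpha u)-1]<\infty$ for some $\alpha>0$ and $\mathbb{E}_p[u]=0$, with norm $\|u\|_p=\inf\{r>0:\mathbb{E}_p[\cosh(u/r)-1]\le 1\}$. For $u\in B_p$ let $K_p(u)=\log\mathbb{E}_p[e^u]\in[0,+\infty]$, $\mathrm{Dom}(K_p)=\{u\in B_p:K_p(u)<\infty\}$, with interior $\mathrm{Dom}(K_p)^\circ$ in $B_p$. The maximal exponential model is $\mathcal{E}_p=\{e^{u-K_p(u)}p:u\in\mathrm{Dom}(K_p)^\circ\}$, a manifold modelled on $B_p$. Fix $d\ge 1$ and $u_1,\ldots,u_d\in B_p$ linearly independent in $L^2(p\cdot\mu)$ (standing assumption). Let $\Theta=\{\theta\in\mathbb{R}^d:\sum_j\theta_ju_j\in\mathrm{Dom}(K_p)^\circ\}$ (open), $\psi(\theta)=K_p(\sum_j\theta_ju_j)$, $p_\theta=e^{\sum_j\theta_ju_j-\psi(\theta)}p$, and $\mathcal{N}=\{p_\theta:\theta\in\Theta\}$. The KL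 divergence is $D_{\mathrm{KL}}(q\|r)=\int_X q\log(q/r)\,d\mu$. The $m$-projection of $q\in\mathcal{E}_p$ onto $\mathcal{N}$ is $\pi^{(m)}(q)=\arg\min_{p_\theta\in\mathcal{N}}D_{\mathrm{KL}}(q\|p_\theta)$; the minimizer is unique whenever it exists. *)

theory Defs
  imports "HOL-Analysis.Analysis"
begin

text \<open>
  Random variables (elements of \<open>B\<^sub>p\<close>) are represented by measurable functions, and every notion
  below that concerns \<open>B\<^sub>p\<close> is invariant under \<open>\<mu>\<close>-a.e. equality. Points of the statistical models
  are genuine \<open>\<mu>\<close>-a.e. classes of densities, so that equality of points and \<open>Metric_space\<close>
  have their usual meaning.
\<close>

definition densities :: "'a measure \<Rightarrow> ('a \<Rightarrow> real) set" where
  "densities M = {p \<in> borel_measurable M. (AE x in M. p x > 0) \<and> integrable M p \<and> (LINT x|M. p x) = 1}"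

definition ae_class :: "'a measure \<Rightarrow> ('a \<Rightarrow> real) \<Rightarrow> ('a \<Rightarrow> real) set" where
  "ae_class M f = {g \<in> borel_measurable M. AE x in M. g x = f x}"

definition ae_rep :: "('a \<Rightarrow> real) set \<Rightarrow> 'a \<Rightarrow> real" where
  "ae_rep Q = (SOME q. q \<in> Q)"

definition expect :: "'a measure \<Rightarrow> ('a \<Rightarrow> real) \<Rightarrow> ('a \<Rightarrow> real) \<Rightarrow> real" where
  "expect M p u = (LINT x|M. u x * p x)"

text \<open>The extended expectation of the nonnegative variable \<open>cosh v - 1\<close> under \<open>p\<close>.\<close>

definition cosh_modular :: "'a measure \<Rightarrow> ('a \<Rightarrow> real) \<Rightarrow> ('a \<Rightarrow> real) \<Rightarrow> ennreal" where
  "cosh_modular M p v = (\<integral>\<^sup>+x. ennreal ((cosh (v x) - 1) * p x) \<partial>M)"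

definition Bsp :: "'a measure \<Rightarrow> ('a \<Rightarrow> real) \<Rightarrow> ('a \<Rightarrow> real) set" where
  "Bsp M p = {u \<in> borel_measurable M.
     (\<exists>\<alpha>>0. cosh_modular M p (\<lambda>x. \<alpha> * u x) < \<infinity>) \<and> expect M p u = 0}"

definition Bnorm :: "'a measure \<Rightarrow> ('a \<Rightarrow> real) \<Rightarrow> ('a \<Rightarrow> real) \<Rightarrow> real" where
  "Bnorm M p u = Inf {r. r > 0 \<and> cosh_modular M p (\<lambda>x. u x / r) \<le> 1}"

text \<open>Infinite dimension of the space of classes: no finite set spans it up to a.e. equality.\<close>

definition Bsp_infinite_dim :: "'a measure \<Rightarrow> ('a \<Rightarrow> real) \<Rightarrow> bool" where
  "Bsp_infinite_dim M p \<longleftrightarrow>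
     \<not> (\<exists>F. finite F \<and> F \<subseteq> Bsp M p \<and>
          (\<forall>u\<in>Bsp M p. \<exists>c :: ('a \<Rightarrow> real) \<Rightarrow> real. AE x in M. u x = (\<Sum>f\<in>F. c f * f x)))"

text \<open>
  For measurable \<open>u\<close> and a density \<open>p\<close>, the function \<open>exp u * p\<close> is a.e. positive, so it fails to
  be integrable exactly when the expectation of \<open>exp u\<close> is infinite.
\<close>

definition Kfun :: "'a measure \<Rightarrow> ('a \<Rightarrow> real) \<Rightarrow> ('a \<Rightarrow> real) \<Rightarrow> ereal" where
  "Kfun M p u =
     (if integrable M (\<lambda>x. exp (u x) * p x) then ereal (ln (expect M p (\<lambda>x. exp (u x)))) else \<infinity>)"

definition KDom :: "'a measure \<Rightarrow> ('a \<Rightarrow> real) \<Rightarrow> ('a \<Rightarrow> real) set" where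
  "KDom M p = {u \<in> Bsp M p. Kfun M p u < \<infinity>}"

definition KDom_interior :: "'a measure \<Rightarrow> ('a \<Rightarrow> real) \<Rightarrow> ('a \<Rightarrow> real) set" where
  "KDom_interior M p =
     {u \<in> KDom M p. \<exists>\<epsilon>>0. \<forall>v\<in>Bsp M p. Bnorm M p (\<lambda>x. v x - u x) < \<epsilon> \<longrightarrow> v \<in> KDom M p}"

definition exp_density :: "'a measure \<Rightarrow> ('a \<Rightarrow> real) \<Rightarrow> ('a \<Rightarrow> real) \<Rightarrow> 'a \<Rightarrow> real" where
  "exp_density M p u = (\<lambda>x. exp (u x - real_of_ereal (Kfun M p u)) * p x)"

definition max_exp_model :: "'a measure \<Rightarrow> ('a \<Rightarrow> real) \<Rightarrow> ('a \<Rightarrow> real) set set" where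
  "max_exp_model M p = {ae_class M (exp_density M p u) | u. u \<in> KDom_interior M p}"

definition lincomb :: "('d::finite \<Rightarrow> 'a \<Rightarrow> real) \<Rightarrow> real ^ 'd \<Rightarrow> 'a \<Rightarrow> real" where
  "lincomb u \<theta> = (\<lambda>x. \<Sum>j\<in>UNIV. \<theta> $ j * u j x)"

text \<open>
  Linear independence in \<open>L\<^sup>2(p \<cdot> \<mu>)\<close>: a combination is the zero vector iff it vanishes
  \<open>p \<cdot> \<mu>\<close>-a.e. (elements of \<open>B\<^sub>p\<close> are automatically square integrable).
\<close>

definition L2_lin_indep :: "'a measure \<Rightarrow> ('a \<Rightarrow> real) \<Rightarrow> ('d::finite \<Rightarrow> 'a \<Rightarrow> real) \<Rightarrow> bool" where
  "L2_lin_indep M p u \<longleftrightarrow>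
     (\<forall>c :: real ^ 'd. (AE x in density M (\<lambda>x. ennreal (p x)). lincomb u c x = 0) \<longrightarrow> c = 0)"

definition nat_params :: "'a measure \<Rightarrow> ('a \<Rightarrow> real) \<Rightarrow> ('d::finite \<Rightarrow> 'a \<Rightarrow> real) \<Rightarrow> (real ^ 'd) set" where
  "nat_params M p u = {\<theta>. lincomb u \<theta> \<in> KDom_interior M p}"

definition exp_family :: "'a measure \<Rightarrow> ('a \<Rightarrow> real) \<Rightarrow> ('d::finite \<Rightarrow> 'a \<Rightarrow> real) \<Rightarrow> ('a \<Rightarrow> real) set set" where
  "exp_family M p u = {ae_class M (exp_density M p (lincomb u \<theta>)) | \<theta>. \<theta> \<in> nat_params M p u}"

text \<open>
  For a.e. positive densities \<open>q\<close>, \<open>r\<close> the negative part of \<open>q * ln (q / r)\<close> is integrable, since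
  \<open>q * ln (r / q) \<le> r - q\<close>; hence non-integrability means that the divergence is \<open>\<infinity>\<close>.
\<close>

definition KL :: "'a measure \<Rightarrow> ('a \<Rightarrow> real) \<Rightarrow> ('a \<Rightarrow> real) \<Rightarrow> ereal" where
  "KL M q r =
     (if integrable M (\<lambda>x. q x * ln (q x / r x)) then ereal (LINT x|M. q x * ln (q x / r x)) else \<infinity>)"

definition class_expect :: "'a measure \<Rightarrow> ('a \<Rightarrow> real) set \<Rightarrow> ('a \<Rightarrow> real) \<Rightarrow> real" where
  "class_expect M Q v = expect M (ae_rep Q) v"

definition class_KL :: "'a measure \<Rightarrow> ('a \<Rightarrow> real) set \<Rightarrow> ('a \<Rightarrow> real) set \<Rightarrow> ereal" where
  "class_KL M Q R = KL M (ae_rep Q) (ae_rep R)"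

definition is_m_projection ::
  "'a measure \<Rightarrow> ('a \<Rightarrow> real) \<Rightarrow> ('d::finite \<Rightarrow> 'a \<Rightarrow> real) \<Rightarrow> ('a \<Rightarrow> real) set \<Rightarrow> ('a \<Rightarrow> real) set \<Rightarrow> bool" where
  "is_m_projection M p u Q R \<longleftrightarrow> is_arg_min (class_KL M Q) (\<lambda>R. R \<in> exp_family M p u) R"

definition m_projection ::
  "'a measure \<Rightarrow> ('a \<Rightarrow> real) \<Rightarrow> ('d::finite \<Rightarrow> 'a \<Rightarrow> real) \<Rightarrow> ('a \<Rightarrow> real) set \<Rightarrow> ('a \<Rightarrow> real) set" where
  "m_projection M p u Q = arg_min_on (class_KL M Q) (exp_family M p u)"

definition proj_dist ::
  "'a measure \<Rightarrow> ('a \<Rightarrow> real) \<Rightarrow> ('d::finite \<Rightarrow> 'a \<Rightarrow> real)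
    \<Rightarrow> (('a \<Rightarrow> real) set \<Rightarrow> ('a \<Rightarrow> real) set \<Rightarrow> real)
    \<Rightarrow> ('a \<Rightarrow> real) set \<Rightarrow> ('a \<Rightarrow> real) set \<Rightarrow> real" where
  "proj_dist M p u \<rho> Q1 Q2 = \<rho> (m_projection M p u Q1) (m_projection M p u Q2)"

text \<open>The functionals on classes do not depend on the chosen representatives.\<close>

lemma ae_class_eq_iff:
  assumes "f \<in> borel_measurable M" "g \<in> borel_measurable M"
  shows "ae_class M f = ae_class M g \<longleftrightarrow> (AE x in M. f x = g x)"
proof
  assume "ae_class M f = ae_class M g"
  moreover have "f \<in> ae_class M f" using assms by (simp add: ae_class_def)
  ultimately show "AE x in M. f x = g x" by (simp add: ae_class_def)
next
  assume fg: "AE x in M. f x = g x"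
  have "(AE x in M. h x = f x) \<longleftrightarrow> (AE x in M. h x = g x)" for h
    using fg by (intro iffI; elim AE_mp) auto
  then show "ae_class M f = ae_class M g" by (simp add: ae_class_def)
qed

lemma ae_rep_ae_class:
  assumes "f \<in> borel_measurable M"
  shows "ae_rep (ae_class M f) \<in> borel_measurable M" "AE x in M. ae_rep (ae_class M f) x = f x"
proof -
  have "f \<in> ae_class M f" using assms by (simp add: ae_class_def)
  then have "ae_rep (ae_class M f) \<in> ae_class M f" unfolding ae_rep_def by (rule someI[where P = "\<lambda>q. q \<in> ae_class M f"])
  then show "ae_rep (ae_class M f) \<in> borel_measurable M" "AE x in M. ae_rep (ae_class M f) x = f x"
    by (simp_all add: ae_class_def)
qed

lemma class_expect_ae_class:
  assumes [measurable]: "f \<in> borel_measurable M" "v \<in> borel_measurable M"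
  shows "class_expect M (ae_class M f) v = expect M f v"
proof -
  note [measurable] = ae_rep_ae_class(1)[OF assms(1)]
  show ?thesis unfolding class_expect_def expect_def
    using ae_rep_ae_class(2)[OF assms(1)] by (intro integral_cong_AE) auto
qed

lemma class_KL_ae_class:
  assumes [measurable]: "f \<in> borel_measurable M" "g \<in> borel_measurable M"
  shows "class_KL M (ae_class M f) (ae_class M g) = KL M f g"
proof -
  let ?F = "ae_rep (ae_class M f)" and ?G = "ae_rep (ae_class M g)"
  note [measurable] = ae_rep_ae_class(1)[OF assms(1)] ae_rep_ae_class(1)[OF assms(2)]
  have *: "AE x in M. ?F x * ln (?F x / ?G x) = f x * ln (f x / g x)"
    using ae_rep_ae_class(2)[OF assms(1)] ae_rep_ae_class(2)[OF assms(2)] by eventually_elim simp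
  have "integrable M (\<lambda>x. ?F x * ln (?F x / ?G x)) \<longleftrightarrow> integrable M (\<lambda>x. f x * ln (f x / g x))"
    by (intro integrable_cong_AE *) auto
  moreover have "(LINT x|M. ?F x * ln (?F x / ?G x)) = (LINT x|M. f x * ln (f x / g x))"
    by (intro integral_cong_AE *) auto
  ultimately show ?thesis by (simp add: class_KL_def KL_def)
qed

end

theory Submission
  imports Defs
begin

text \<open>
  The axioms (i)-(iii) and the vanishing on the diagonal are pulled back from the metric \<open>\<rho>\<close>. The
  content lies in the description of the zero set and in the existence of two different points at
  distance zero.

  For \<open>q = exp (w - K w) p\<close> in the maximal exponential model, the divergence from \<open>q\<close> to the member of
  the family with parameter \<open>\<theta>\<close> is
  \<open>D(q || p\<^sub>\<theta>) = c\<^sub>q + (\<psi> \<theta> - (\<Sum>j. \<theta>\<^sub>j E\<^sub>q[u\<^sub>j]))\<close>,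
  with \<open>c\<^sub>q\<close> independent of \<open>\<theta>\<close> (\<open>class_KL_exp_family\<close>). So \<open>q\<close> enters the minimisation only through
  its moments \<open>E\<^sub>q[u\<^sub>j]\<close>, and densities with equal moments have the same projection
  (\<open>m_projection_cong_moments\<close>). Conversely a projection has the same moments as \<open>q\<close>
  (\<open>m_projection_moments\<close>), which is the first-order condition \<open>\<nabla>\<psi> \<theta> = E\<^sub>q[u]\<close> at a minimiser in the
  open parameter set; hence equal projections force equal moments. In place of differentiability
  of \<open>\<psi>\<close>, the first-order condition is read off from the one-sided bound
  \<open>K (w + t v) \<le> K w + t E\<^sub>q[v] + C t\<^sup>2\<close> (\<open>Kfun_second_order_bound\<close>).

  For the degeneracy, \<open>p\<close> is compared with \<open>(1 + b) p\<close>, where \<open>b\<close> is bounded by \<open>1/2\<close>, not a.e. zero,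
  and orthogonal under \<open>p\<close> to \<open>1\<close> and to every \<open>u\<^sub>j\<close>. Such a \<open>b\<close> exists because these are only
  \<open>d + 1\<close> linear conditions on an infinite-dimensional space of bounded functions
  (\<open>exists_bounded_orthogonal\<close>), and \<open>(1 + b) p\<close> lies in the model because the logarithm of \<open>1 + b\<close>
  is bounded (\<open>bounded_perturbation_in_max_exp_model\<close>).
\<close>

section \<open>Exponential moments and the Luxemburg norm\<close>

lemma cosh_le_exp_abs: "cosh (y::real) \<le> exp \<bar>y\<bar>"
  by (cases "y \<ge> 0") (simp_all add: cosh_field_def)

lemma borel_measurable_cosh [measurable (raw)]:
  fixes f :: "'a \<Rightarrow> real"
  assumes "f \<in> borel_measurable M"
  shows "(\<lambda>x. cosh (f x)) \<in> borel_measurable M"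
  using measurable_compose[OF assms borel_measurable_continuous_onI[OF continuous_on_cosh[OF continuous_on_id]]] .

lemma abs_le_exp_abs: "\<bar>y::real\<bar> \<le> exp \<bar>y\<bar>"
  using exp_ge_add_one_self[of "\<bar>y\<bar>"] by linarith

lemma exp_abs_le_cosh: "exp \<bar>y::real\<bar> \<le> 2 * cosh y"
  by (cases "y \<ge> 0") (simp_all add: cosh_field_def)

lemma cosh_convex:
  fixes x y a b :: real
  assumes "a \<ge> 0" "b \<ge> 0" "a + b = 1"
  shows "cosh (a * x + b * y) \<le> a * cosh x + b * cosh y"
proof -
  have 1: "exp (a * x + b * y) \<le> a * exp x + b * exp y" for x y :: real
  proof -
    have a: "a = 1 - b" using assms by simp
    show ?thesis using convex_onD[OF exp_convex, of b x y] assms unfolding a by simp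
  qed
  have "exp (- (a * x + b * y)) \<le> a * exp (- x) + b * exp (- y)"
    using 1[of "-x" "-y"] by simp
  with 1[of x y] show ?thesis
    by (simp add: cosh_field_def field_simps)
qed

text \<open>
  The quadratic Taylor remainder with its exponential growth absorbed into \<open>exp \<bar>y\<bar>\<close>: since \<open>\<bar>s\<bar> \<le> 1/2\<close>,
  only half of the exponent is spent on the remainder, and the other half dominates \<open>y\<^sup>2\<close>.
\<close>

lemma exp_second_order_bound:
  fixes s y :: real
  assumes "\<bar>s\<bar> \<le> 1/2"
  shows "exp (s * y) \<le> 1 + s * y + 4 * s\<^sup>2 * exp \<bar>y\<bar>"
proof -
  obtain \<xi> where xi: "\<bar>\<xi>\<bar> \<le> \<bar>s * y\<bar>"
    "exp (s * y) = (\<Sum>m<2. (s * y) ^ m / fact m) + exp \<xi> / fact 2 * (s * y) ^ 2"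
    using Maclaurin_exp_le[of "s * y" 2] by blast
  have "\<bar>s * y\<bar> \<le> 1/2 * \<bar>y\<bar>" using assms unfolding abs_mult by (intro mult_right_mono) auto
  then have "exp \<xi> \<le> exp (\<bar>y\<bar> / 2)" using xi(1) by simp
  moreover have "y\<^sup>2 \<le> 8 * exp (\<bar>y\<bar> / 2)"
    using exp_lower_Taylor_quadratic[of "\<bar>y\<bar> / 2"] by (simp add: power_divide)
  ultimately have "exp \<xi> * y\<^sup>2 \<le> exp (\<bar>y\<bar> / 2) * (8 * exp (\<bar>y\<bar> / 2))"
    by (intro mult_mono) auto
  also have "\<dots> = 8 * exp \<bar>y\<bar>" by (simp flip: exp_add)
  finally have "s\<^sup>2 * (exp \<xi> * y\<^sup>2) \<le> s\<^sup>2 * (8 * exp \<bar>y\<bar>)" by (rule mult_left_mono) simp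
  with xi(2) show ?thesis
    by (simp add: numeral_2_eq_2 power_mult_distrib algebra_simps)
qed

lemma densitiesD:
  assumes "p \<in> densities M"
  shows "p \<in> borel_measurable M" "AE x in M. 0 < p x" "AE x in M. 0 \<le> p x"
    "integrable M p" "(LINT x|M. p x) = 1"
  using assms by (auto simp: densities_def elim: AE_mp)

lemma integrable_weighted_bound:
  fixes F G q :: "'a \<Rightarrow> real"
  assumes "integrable M (\<lambda>x. G x * q x)" "F \<in> borel_measurable M" "q \<in> borel_measurable M"
    and "\<And>x. \<bar>F x\<bar> \<le> G x"
  shows "integrable M (\<lambda>x. F x * q x)"
proof (rule Bochner_Integration.integrable_bound[OF assms(1)])
  show "(\<lambda>x. F x * q x) \<in> borel_measurable M" using assms by measurable
  have "\<bar>F x\<bar> * \<bar>q x\<bar> \<le> \<bar>G x\<bar> * \<bar>q x\<bar>" for x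
    using assms(4)[of x] by (intro mult_right_mono) auto
  then show "AE x in M. norm (F x * q x) \<le> norm (G x * q x)" by (simp add: abs_mult)
qed

context
  fixes M :: "'a measure" and p :: "'a \<Rightarrow> real"
  assumes p: "p \<in> densities M"
begin

lemmas p_dens = densitiesD[OF p]

lemma p_measurable [measurable]: "p \<in> borel_measurable M"
  by (rule p_dens)

lemma integrable_bounded_weighted:
  assumes "F \<in> borel_measurable M" "\<And>x. \<bar>F x\<bar> \<le> (C::real)"
  shows "integrable M (\<lambda>x. F x * p x)"
  by (rule integrable_weighted_bound[of M "\<lambda>_. C"]) (use assms p_dens in auto)

text \<open>
  Exponentials of \<open>\<bar>f\<bar>\<close> are easier to dominate than the modular itself; the two are interchangeable
  because \<open>cosh y \<le> exp \<bar>y\<bar> \<le> 2 cosh y\<close> and \<open>p\<close> has finite mass.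
\<close>

lemma cosh_modular_finite_iff:
  assumes [measurable]: "f \<in> borel_measurable M"
  shows "cosh_modular M p f < \<infinity> \<longleftrightarrow> integrable M (\<lambda>x. exp \<bar>f x\<bar> * p x)"
proof
  assume fin: "cosh_modular M p f < \<infinity>"
  have "integrable M (\<lambda>x. (cosh (f x) - 1) * p x)"
  proof (rule integrableI_nonneg)
    show "AE x in M. 0 \<le> (cosh (f x) - 1) * p x"
      using p_dens(3) by eventually_elim (simp add: cosh_real_ge_1)
    show "(\<integral>\<^sup>+ x. ennreal ((cosh (f x) - 1) * p x) \<partial>M) < \<infinity>"
      using fin by (simp add: cosh_modular_def)
  qed measurable
  then have "integrable M (\<lambda>x. 2 * ((cosh (f x) - 1) * p x + p x))"
    using p_dens(4) by auto
  then have "integrable M (\<lambda>x. (2 * cosh (f x)) * p x)"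
    by (simp add: algebra_simps)
  then show "integrable M (\<lambda>x. exp \<bar>f x\<bar> * p x)"
    by (rule integrable_weighted_bound) (auto simp: exp_abs_le_cosh)
next
  assume "integrable M (\<lambda>x. exp \<bar>f x\<bar> * p x)"
  then have "integrable M (\<lambda>x. (cosh (f x) - 1) * p x)"
  proof (rule integrable_weighted_bound)
    show "\<bar>cosh (f x) - 1\<bar> \<le> exp \<bar>f x\<bar>" for x
      using cosh_le_exp_abs[of "f x"] cosh_real_ge_1[of "f x"] by simp
  qed auto
  moreover have "AE x in M. 0 \<le> (cosh (f x) - 1) * p x"
    using p_dens(3) by eventually_elim (simp add: cosh_real_ge_1)
  ultimately show "cosh_modular M p f < \<infinity>"
    unfolding cosh_modular_def by (subst nn_integral_eq_integral) auto
qed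

lemma Bsp_iff:
  "u \<in> Bsp M p \<longleftrightarrow> u \<in> borel_measurable M \<and>
    (\<exists>\<alpha>>0. integrable M (\<lambda>x. exp (\<alpha> * \<bar>u x\<bar>) * p x)) \<and> expect M p u = 0"
proof -
  have *: "(cosh_modular M p (\<lambda>x. \<alpha> * u x) < \<infinity>) \<longleftrightarrow> integrable M (\<lambda>x. exp (\<alpha> * \<bar>u x\<bar>) * p x)"
    if "\<alpha> > 0" "u \<in> borel_measurable M" for \<alpha>
    using cosh_modular_finite_iff[of "\<lambda>x. \<alpha> * u x"] that by (simp add: abs_mult)
  show ?thesis unfolding Bsp_def using * by blast
qed

lemma Bsp_measurable: "u \<in> Bsp M p \<Longrightarrow> u \<in> borel_measurable M"
  by (simp add: Bsp_def)

lemma Bsp_integrable: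
  assumes "u \<in> Bsp M p"
  shows "integrable M (\<lambda>x. u x * p x)"
proof -
  from assms obtain \<alpha> where a: "\<alpha> > 0" "integrable M (\<lambda>x. exp (\<alpha> * \<bar>u x\<bar>) * p x)"
    and [measurable]: "u \<in> borel_measurable M" by (auto simp: Bsp_iff)
  have "integrable M (\<lambda>x. (\<alpha> * u x) * p x)"
  proof (rule integrable_weighted_bound[OF a(2)])
    show "\<bar>\<alpha> * u x\<bar> \<le> exp (\<alpha> * \<bar>u x\<bar>)" for x
      using abs_le_exp_abs[of "\<alpha> * u x"] a(1) by (simp add: abs_mult)
  qed auto
  then have "integrable M (\<lambda>x. (1/\<alpha>) * ((\<alpha> * u x) * p x))" by (rule integrable_mult_right)
  then show ?thesis using a(1) by simp
qed

lemma integrable_bounded_mult_Bsp: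
  assumes [measurable]: "b \<in> borel_measurable M" and b: "\<And>x. \<bar>b x\<bar> \<le> (C::real)" and v: "v \<in> Bsp M p"
  shows "integrable M (\<lambda>x. b x * v x * p x)"
proof (rule Bochner_Integration.integrable_bound)
  note [measurable] = Bsp_measurable[OF v]
  show "integrable M (\<lambda>x. C * (v x * p x))" using Bsp_integrable[OF v] by simp
  have "\<bar>b x\<bar> * \<bar>v x * p x\<bar> \<le> \<bar>C\<bar> * \<bar>v x * p x\<bar>" for x
    using b[of x] by (intro mult_right_mono) auto
  then show "AE x in M. norm (b x * v x * p x) \<le> norm (C * (v x * p x))"
    by (simp add: abs_mult mult.assoc)
  show "(\<lambda>x. b x * v x * p x) \<in> borel_measurable M" by measurable
qed

lemma Bsp_scale:
  assumes "u \<in> Bsp M p"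
  shows "(\<lambda>x. c * u x) \<in> Bsp M p"
proof -
  from assms obtain \<alpha> where a: "\<alpha> > 0" "integrable M (\<lambda>x. exp (\<alpha> * \<bar>u x\<bar>) * p x)"
    and [measurable]: "u \<in> borel_measurable M" and 0: "expect M p u = 0" by (auto simp: Bsp_iff)
  have "integrable M (\<lambda>x. exp (\<alpha> / (\<bar>c\<bar> + 1) * \<bar>c * u x\<bar>) * p x)"
  proof (rule integrable_weighted_bound[OF a(2)])
    fix x
    have "\<alpha> / (\<bar>c\<bar> + 1) * \<bar>c * u x\<bar> = (\<alpha> * \<bar>u x\<bar>) * (\<bar>c\<bar> / (\<bar>c\<bar> + 1))"
      by (simp add: abs_mult)
    also have "\<dots> \<le> (\<alpha> * \<bar>u x\<bar>) * 1" using a(1) by (intro mult_left_mono) auto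
    finally show "\<bar>exp (\<alpha> / (\<bar>c\<bar> + 1) * \<bar>c * u x\<bar>)\<bar> \<le> exp (\<alpha> * \<bar>u x\<bar>)" by simp
  qed auto
  moreover have "\<alpha> / (\<bar>c\<bar> + 1) > 0" using a(1) by simp
  moreover have "expect M p (\<lambda>x. c * u x) = 0" using 0 by (simp add: expect_def mult.assoc)
  ultimately show ?thesis unfolding Bsp_iff by fastforce
qed

lemma Bsp_add:
  assumes u: "u \<in> Bsp M p" and v: "v \<in> Bsp M p"
  shows "(\<lambda>x. u x + v x) \<in> Bsp M p"
proof -
  from u obtain \<alpha> where a: "\<alpha> > 0" "integrable M (\<lambda>x. exp (\<alpha> * \<bar>u x\<bar>) * p x)"
    and [measurable]: "u \<in> borel_measurable M" and u0: "expect M p u = 0" by (auto simp: Bsp_iff)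
  from v obtain \<beta> where b: "\<beta> > 0" "integrable M (\<lambda>x. exp (\<beta> * \<bar>v x\<bar>) * p x)"
    and [measurable]: "v \<in> borel_measurable M" and v0: "expect M p v = 0" by (auto simp: Bsp_iff)
  define \<gamma> where "\<gamma> = min \<alpha> \<beta> / 2"
  have g: "\<gamma> > 0" "2 * \<gamma> \<le> \<alpha>" "2 * \<gamma> \<le> \<beta>" using a(1) b(1) by (auto simp: \<gamma>_def)
  have "integrable M (\<lambda>x. (exp (\<alpha> * \<bar>u x\<bar>) + exp (\<beta> * \<bar>v x\<bar>)) * p x)"
    using a(2) b(2) by (auto simp: distrib_right)
  then have "integrable M (\<lambda>x. exp (\<gamma> * \<bar>u x + v x\<bar>) * p x)"
  proof (rule integrable_weighted_bound)
    fix x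
    have *: "\<gamma> * \<bar>u x + v x\<bar> \<le> \<gamma> * \<bar>u x\<bar> + \<gamma> * \<bar>v x\<bar>"
      using g(1) by (simp flip: distrib_left)
    have 1: "(2 * \<gamma>) * \<bar>u x\<bar> \<le> \<alpha> * \<bar>u x\<bar>" "(2 * \<gamma>) * \<bar>v x\<bar> \<le> \<beta> * \<bar>v x\<bar>"
      using g by (auto intro!: mult_right_mono simp del: mult.assoc)
    have "\<gamma> * \<bar>u x + v x\<bar> \<le> max (\<alpha> * \<bar>u x\<bar>) (\<beta> * \<bar>v x\<bar>)" using * 1 by linarith
    then have "exp (\<gamma> * \<bar>u x + v x\<bar>) \<le> exp (max (\<alpha> * \<bar>u x\<bar>) (\<beta> * \<bar>v x\<bar>))" by simp
    also have "\<dots> \<le> exp (\<alpha> * \<bar>u x\<bar>) + exp (\<beta> * \<bar>v x\<bar>)" by (simp add: max_def)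
    finally show "\<bar>exp (\<gamma> * \<bar>u x + v x\<bar>)\<bar> \<le> exp (\<alpha> * \<bar>u x\<bar>) + exp (\<beta> * \<bar>v x\<bar>)" by simp
  qed auto
  moreover have "expect M p (\<lambda>x. u x + v x) = 0"
    using u0 v0 Bsp_integrable[OF u] Bsp_integrable[OF v]
    by (simp add: expect_def distrib_right)
  ultimately show ?thesis using g(1) unfolding Bsp_iff by auto
qed

lemma Bsp_diff: "u \<in> Bsp M p \<Longrightarrow> v \<in> Bsp M p \<Longrightarrow> (\<lambda>x. u x - v x) \<in> Bsp M p"
  using Bsp_add[of u "\<lambda>x. (-1) * v x"] Bsp_scale[of v "-1"] by simp

lemma cosh_modular_convex:
  assumes [measurable]: "f \<in> borel_measurable M" "g \<in> borel_measurable M"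
    and ab: "a \<ge> 0" "b \<ge> 0" "a + b = 1"
  shows "cosh_modular M p (\<lambda>x. a * f x + b * g x)
    \<le> ennreal a * cosh_modular M p f + ennreal b * cosh_modular M p g"
proof -
  have nn: "0 \<le> cosh y - 1" for y :: real by (simp add: cosh_real_ge_1)
  have "cosh_modular M p (\<lambda>x. a * f x + b * g x)
    \<le> (\<integral>\<^sup>+x. (ennreal a * ennreal ((cosh (f x) - 1) * p x)
              + ennreal b * ennreal ((cosh (g x) - 1) * p x)) \<partial>M)"
    unfolding cosh_modular_def
  proof (rule nn_integral_mono_AE)
    show "AE x in M. ennreal ((cosh (a * f x + b * g x) - 1) * p x)
      \<le> ennreal a * ennreal ((cosh (f x) - 1) * p x) + ennreal b * ennreal ((cosh (g x) - 1) * p x)"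
      using p_dens(3)
    proof eventually_elim
      case (elim x)
      have "cosh (a * f x + b * g x) - 1 \<le> a * cosh (f x) + b * cosh (g x) - (a + b)"
        using cosh_convex[OF ab, of "f x" "g x"] ab by simp
      then have "(cosh (a * f x + b * g x) - 1) * p x
          \<le> (a * (cosh (f x) - 1) + b * (cosh (g x) - 1)) * p x"
        using elim by (intro mult_right_mono) (auto simp: algebra_simps)
      then have "ennreal ((cosh (a * f x + b * g x) - 1) * p x)
          \<le> ennreal (a * ((cosh (f x) - 1) * p x) + b * ((cosh (g x) - 1) * p x))"
        by (intro ennreal_leI) (simp add: algebra_simps)
      then show ?case using elim ab nn by (simp add: ennreal_plus ennreal_mult)
    qed
  qed
  also have "\<dots> = ennreal a * cosh_modular M p f + ennreal b * cosh_modular M p g"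
    unfolding cosh_modular_def by (simp add: nn_integral_add nn_integral_cmult)
  finally show ?thesis .
qed

text \<open>
  Convexity and \<open>cosh 0 = 1\<close> make the modular shrink at least linearly along rays, so a finite value
  somewhere on a ray becomes a value below \<open>1\<close> near the origin. This shows both that the Luxemburg
  norm is an infimum over a nonempty set and that it is continuous at \<open>0\<close> along rays.
\<close>

lemma cosh_modular_small:
  assumes "u \<in> Bsp M p"
  shows "\<exists>\<beta>>0. \<forall>s. \<bar>s\<bar> \<le> \<beta> \<longrightarrow> cosh_modular M p (\<lambda>x. s * u x) \<le> 1"
proof -
  from assms obtain \<alpha> where a: "\<alpha> > 0" "cosh_modular M p (\<lambda>x. \<alpha> * u x) < \<infinity>"
    and [measurable]: "u \<in> borel_measurable M" by (auto simp: Bsp_def)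
  define C where "C = enn2real (cosh_modular M p (\<lambda>x. \<alpha> * u x))"
  have C: "cosh_modular M p (\<lambda>x. \<alpha> * u x) = ennreal C" "C \<ge> 0"
    using a(2) by (auto simp: C_def)
  show ?thesis
  proof (intro exI conjI allI impI)
    show "\<alpha> / (C + 1) > 0" using a(1) C(2) by simp
    fix s assume s: "\<bar>s\<bar> \<le> \<alpha> / (C + 1)"
    define r where "r = \<bar>s\<bar> / \<alpha>"
    have r: "r \<ge> 0" "\<bar>s\<bar> = r * \<alpha>"
      using a(1) by (auto simp: r_def)
    have "r \<le> \<alpha> / (C + 1) / \<alpha>"
      unfolding r_def using s a(1) by (intro divide_right_mono) auto
    then have rC1: "r \<le> 1 / (C + 1)" using a(1) by simp
    also have "\<dots> \<le> 1" using C(2) by simp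
    finally have r1: "r \<le> 1" .
    have rC: "r * C \<le> 1"
    proof -
      have "r * C \<le> 1 / (C + 1) * C" using rC1 C(2) by (intro mult_right_mono)
      also have "\<dots> \<le> 1" using C(2) by simp
      finally show ?thesis .
    qed
    have abs: "cosh (s * y) = cosh (\<bar>s\<bar> * y)" for y
      by (cases "s \<ge> 0") auto
    have "cosh_modular M p (\<lambda>x. s * u x) = cosh_modular M p (\<lambda>x. r * (\<alpha> * u x) + (1 - r) * 0)"
      unfolding cosh_modular_def abs r(2) by (simp add: mult.assoc)
    also have "\<dots> \<le> ennreal r * cosh_modular M p (\<lambda>x. \<alpha> * u x)
        + ennreal (1 - r) * cosh_modular M p (\<lambda>x. 0)"
      using r1 r(1) by (intro cosh_modular_convex) auto
    also have "\<dots> = ennreal (r * C)"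
      using r(1) C by (simp add: cosh_modular_def ennreal_mult)
    also have "\<dots> \<le> 1" using rC by simp
    finally show "cosh_modular M p (\<lambda>x. s * u x) \<le> 1" .
  qed
qed

lemma Bnorm_le:
  assumes "r > 0" "cosh_modular M p (\<lambda>x. u x / r) \<le> 1"
  shows "Bnorm M p u \<le> r"
  unfolding Bnorm_def using assms by (intro cInf_lower) (auto intro!: bdd_belowI[of _ 0])

lemma Bnorm_lessD:
  assumes "u \<in> Bsp M p" "Bnorm M p u < \<epsilon>"
  obtains r where "r > 0" "r < \<epsilon>" "cosh_modular M p (\<lambda>x. u x / r) \<le> 1"
proof -
  obtain \<beta> where b: "\<beta> > 0" "cosh_modular M p (\<lambda>x. \<beta> * u x) \<le> 1"
    using cosh_modular_small[OF assms(1)] by (metis abs_of_pos order_refl)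
  then have "1 / \<beta> \<in> {r. r > 0 \<and> cosh_modular M p (\<lambda>x. u x / r) \<le> 1}"
    by (simp add: mult.commute)
  then have "{r. r > 0 \<and> cosh_modular M p (\<lambda>x. u x / r) \<le> 1} \<noteq> {}" by blast
  then have "\<exists>r\<in>{r. r > 0 \<and> cosh_modular M p (\<lambda>x. u x / r) \<le> 1}. r < \<epsilon>"
    using assms(2) unfolding Bnorm_def by (rule cInf_lessD)
  then show thesis using that by auto
qed

text \<open>
  The triangle inequality in the form needed to move from one ball to another: \<open>(u + v) / (r + s)\<close>
  is the convex combination of \<open>u / r\<close> and \<open>v / s\<close> with weights \<open>r / (r + s)\<close> and \<open>s / (r + s)\<close>.
\<close>

lemma Bnorm_add_less:
  assumes u: "u \<in> Bsp M p" "Bnorm M p u < \<epsilon>" and v: "v \<in> Bsp M p" "Bnorm M p v < \<delta>"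
  shows "Bnorm M p (\<lambda>x. u x + v x) < \<epsilon> + \<delta>"
proof -
  note [measurable] = Bsp_measurable[OF u(1)] Bsp_measurable[OF v(1)]
  obtain r where r: "r > 0" "r < \<epsilon>" "cosh_modular M p (\<lambda>x. u x / r) \<le> 1"
    using Bnorm_lessD[OF u] .
  obtain s where s: "s > 0" "s < \<delta>" "cosh_modular M p (\<lambda>x. v x / s) \<le> 1"
    using Bnorm_lessD[OF v] .
  let ?a = "r / (r + s)" and ?b = "s / (r + s)"
  have ab: "?a \<ge> 0" "?b \<ge> 0" "?a + ?b = 1"
    using r s by (auto simp flip: add_divide_distrib)
  have "(\<lambda>x. (u x + v x) / (r + s)) = (\<lambda>x. ?a * (u x / r) + ?b * (v x / s))"
    using r s by (auto simp: fun_eq_iff add_divide_distrib)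
  then have "cosh_modular M p (\<lambda>x. (u x + v x) / (r + s))
      \<le> ennreal ?a * cosh_modular M p (\<lambda>x. u x / r) + ennreal ?b * cosh_modular M p (\<lambda>x. v x / s)"
    using cosh_modular_convex[of "\<lambda>x. u x / r" "\<lambda>x. v x / s", OF _ _ ab] by simp
  also have "\<dots> \<le> ennreal ?a * 1 + ennreal ?b * 1"
    using r s by (intro add_mono mult_left_mono) auto
  also have "\<dots> = 1"
    using ab by (simp flip: ennreal_plus del: times_divide_eq_left)
  finally have "Bnorm M p (\<lambda>x. u x + v x) \<le> r + s"
    using r s by (intro Bnorm_le) auto
  then show ?thesis using r s by linarith
qed

lemma Bnorm_scale_small:
  assumes "u \<in> Bsp M p" "\<epsilon> > 0"
  shows "\<exists>\<delta>>0. \<forall>t. \<bar>t\<bar> \<le> \<delta> \<longrightarrow> Bnorm M p (\<lambda>x. t * u x) < \<epsilon>"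
proof -
  obtain \<beta> where b: "\<beta> > 0" "\<And>s. \<bar>s\<bar> \<le> \<beta> \<Longrightarrow> cosh_modular M p (\<lambda>x. s * u x) \<le> 1"
    using cosh_modular_small[OF assms(1)] by blast
  have "Bnorm M p (\<lambda>x. t * u x) \<le> \<epsilon> / 2" if "\<bar>t\<bar> \<le> \<beta> * (\<epsilon> / 2)" for t
  proof (rule Bnorm_le)
    have "\<bar>t / (\<epsilon> / 2)\<bar> \<le> \<beta>" using that assms(2) by (simp add: field_simps)
    from b(2)[OF this] show "cosh_modular M p (\<lambda>x. t * u x / (\<epsilon> / 2)) \<le> 1"
      by (simp only: times_divide_eq_left)
  qed (use assms(2) in simp)
  then show ?thesis using assms(2) b(1) by (intro exI[of _ "\<beta> * (\<epsilon> / 2)"]) (auto, fastforce)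
qed

section \<open>The interior of the domain of the cumulant functional\<close>

lemma KDom_iff: "w \<in> KDom M p \<longleftrightarrow> w \<in> Bsp M p \<and> integrable M (\<lambda>x. exp (w x) * p x)"
  by (auto simp: KDom_def Kfun_def)

lemma KDom_interiorD:
  assumes "w \<in> KDom_interior M p"
  shows "w \<in> Bsp M p" "w \<in> borel_measurable M" "integrable M (\<lambda>x. exp (w x) * p x)"
  using assms by (auto simp: KDom_interior_def KDom_iff Bsp_measurable)

lemma exp_weighted_integral_pos:
  assumes "integrable M (\<lambda>x. exp (w x) * p x)"
  shows "0 < (LINT x|M. exp (w x) * p x)"
proof -
  have nn: "AE x in M. 0 \<le> exp (w x) * p x" using p_dens(3) by eventually_elim simp
  have "(LINT x|M. exp (w x) * p x) \<noteq> 0"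
  proof
    assume "(LINT x|M. exp (w x) * p x) = 0"
    then have "AE x in M. exp (w x) * p x = 0"
      using integral_nonneg_eq_0_iff_AE[OF assms nn] by simp
    then have "AE x in M. p x = 0" by eventually_elim simp
    then have "(LINT x|M. p x) = (LINT x|M. 0)" by (intro integral_cong_AE) auto
    then show False using p_dens(5) by simp
  qed
  moreover have "0 \<le> (LINT x|M. exp (w x) * p x)" using nn by (rule integral_nonneg_AE)
  ultimately show ?thesis by simp
qed

lemma exp_Kfun:
  assumes "integrable M (\<lambda>x. exp (w x) * p x)"
  shows "exp (real_of_ereal (Kfun M p w)) = (LINT x|M. exp (w x) * p x)"
  using assms exp_weighted_integral_pos[OF assms] by (simp add: Kfun_def expect_def)

lemma exp_density_measurable:
  assumes [measurable]: "w \<in> borel_measurable M"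
  shows "exp_density M p w \<in> borel_measurable M"
  unfolding exp_density_def by measurable

lemma exp_density_pos: "AE x in M. 0 < exp_density M p w x"
  using p_dens(2) by eventually_elim (simp add: exp_density_def)

lemma exp_density_integral:
  assumes "integrable M (\<lambda>x. exp (w x) * p x)"
  shows "integrable M (exp_density M p w)" "(LINT x|M. exp_density M p w x) = 1"
proof -
  have eq: "exp_density M p w = (\<lambda>x. (exp (w x) * p x) / exp (real_of_ereal (Kfun M p w)))"
    by (simp add: exp_density_def exp_diff)
  show "integrable M (exp_density M p w)" unfolding eq using assms by simp
  show "(LINT x|M. exp_density M p w x) = 1" unfolding eq
    using exp_Kfun[OF assms] exp_weighted_integral_pos[OF assms] by simp
qed

text \<open>
  The interior is open along lines. This is what makes a minimiser over the exponential family an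
  interior one, to which a first-order condition applies.
\<close>

lemma KDom_interior_perturb:
  assumes w: "w \<in> KDom_interior M p" and v: "v \<in> Bsp M p"
  shows "\<exists>\<delta>>0. \<forall>t. \<bar>t\<bar> \<le> \<delta> \<longrightarrow> (\<lambda>x. w x + t * v x) \<in> KDom_interior M p"
proof -
  obtain \<epsilon> where e: "\<epsilon> > 0"
    and ball: "\<And>v. v \<in> Bsp M p \<Longrightarrow> Bnorm M p (\<lambda>x. v x - w x) < \<epsilon> \<Longrightarrow> v \<in> KDom M p"
    using w by (auto simp: KDom_interior_def)
  obtain \<delta> where d: "\<delta> > 0" "\<And>t. \<bar>t\<bar> \<le> \<delta> \<Longrightarrow> Bnorm M p (\<lambda>x. t * v x) < \<epsilon> / 2"
    using Bnorm_scale_small[OF v, of "\<epsilon> / 2"] e by auto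
  have "(\<lambda>x. w x + t * v x) \<in> KDom_interior M p" if t: "\<bar>t\<bar> \<le> \<delta>" for t
  proof -
    let ?w' = "\<lambda>x. w x + t * v x"
    have tv: "(\<lambda>x. t * v x) \<in> Bsp M p" using v by (rule Bsp_scale)
    have B: "?w' \<in> Bsp M p" using KDom_interiorD(1)[OF w] tv by (rule Bsp_add)
    have "?w' \<in> KDom M p" using ball[OF B] d(2)[OF t] e by simp
    moreover have "z \<in> KDom M p"
      if z: "z \<in> Bsp M p" and zw: "Bnorm M p (\<lambda>x. z x - ?w' x) < \<epsilon> / 2" for z
    proof (rule ball[OF z])
      have "Bnorm M p (\<lambda>x. (z x - ?w' x) + t * v x) < \<epsilon> / 2 + \<epsilon> / 2"
        using Bnorm_add_less[OF Bsp_diff[OF z B] zw tv d(2)[OF t]] .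
      then show "Bnorm M p (\<lambda>x. z x - w x) < \<epsilon>" by (simp add: algebra_simps)
    qed
    ultimately show ?thesis unfolding KDom_interior_def using e by (auto intro!: exI[of _ "\<epsilon> / 2"])
  qed
  then show ?thesis using d(1) by blast
qed

text \<open>
  The open unit ball around a bounded \<open>w\<close> stays in the domain: if the norm of \<open>z - w\<close> is less than
  \<open>1\<close>, then \<open>exp \<bar>z - w\<bar>\<close> is integrable under \<open>p\<close>, and \<open>exp z\<close> exceeds it by at most a constant factor.
\<close>

lemma bounded_in_KDom_interior:
  assumes [measurable]: "w \<in> borel_measurable M" and C: "\<And>x. \<bar>w x\<bar> \<le> C" and 0: "expect M p w = 0"
  shows "w \<in> KDom_interior M p"
proof -
  have "integrable M (\<lambda>x. exp (1 * \<bar>w x\<bar>) * p x)"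
    using C by (intro integrable_bounded_weighted[of _ "exp C"]) auto
  then have B: "w \<in> Bsp M p" unfolding Bsp_iff using 0 by (auto intro!: exI[of _ 1])
  have "z \<in> KDom M p" if z: "z \<in> Bsp M p" and zw: "Bnorm M p (\<lambda>x. z x - w x) < 1" for z
  proof -
    note [measurable] = Bsp_measurable[OF z]
    obtain r where r: "r > 0" "r < 1" "cosh_modular M p (\<lambda>x. (z x - w x) / r) \<le> 1"
      using Bnorm_lessD[OF Bsp_diff[OF z B] zw] .
    from r(3) have "cosh_modular M p (\<lambda>x. (z x - w x) / r) < \<infinity>"
      using le_less_trans by fastforce
    then have "integrable M (\<lambda>x. exp \<bar>(z x - w x) / r\<bar> * p x)"
      by (rule iffD1[OF cosh_modular_finite_iff, rotated]) measurable
    then have "integrable M (\<lambda>x. exp C * (exp \<bar>(z x - w x) / r\<bar> * p x))" by simp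
    then have "integrable M (\<lambda>x. (exp C * exp \<bar>(z x - w x) / r\<bar>) * p x)"
      by (simp add: mult.assoc)
    then have "integrable M (\<lambda>x. exp (z x) * p x)"
    proof (rule integrable_weighted_bound)
      fix x
      have "\<bar>z x - w x\<bar> \<le> \<bar>(z x - w x) / r\<bar>"
        using r(1,2) by (simp add: abs_divide field_simps mult_left_le_one_le)
      then have "z x \<le> C + \<bar>(z x - w x) / r\<bar>" using C[of x] by linarith
      then show "\<bar>exp (z x)\<bar> \<le> exp C * exp \<bar>(z x - w x) / r\<bar>" by (simp flip: exp_add)
    qed auto
    then show ?thesis using z by (simp add: KDom_iff)
  qed
  moreover have "integrable M (\<lambda>x. exp (w x) * p x)"
    using C by (intro integrable_bounded_weighted[of _ "exp C"]) (auto simp: abs_le_iff)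
  ultimately show ?thesis unfolding KDom_interior_def using B by (auto simp: KDom_iff intro!: exI[of _ 1])
qed

lemma exp_density_weighted:
  "(\<lambda>x. F x * exp_density M p w x)
    = (\<lambda>x. (F x * exp (w x) * p x) / exp (real_of_ereal (Kfun M p w)))"
  by (simp add: exp_density_def exp_diff mult.assoc)

text \<open>
  At an interior point \<open>w\<close> the two perturbations \<open>w \<plusminus> \<delta> v\<close> stay in the domain, which yields a
  two-sided exponential moment of \<open>v\<close> under the tilted density, not just under \<open>p\<close>. All integrability
  under members of the model comes from here.
\<close>

lemma KDom_interior_exp_moment:
  assumes w: "w \<in> KDom_interior M p" and v: "v \<in> Bsp M p"
  shows "\<exists>\<delta>>0. (\<forall>t. \<bar>t\<bar> \<le> \<delta> \<longrightarrow> (\<lambda>x. w x + t * v x) \<in> KDom_interior M p)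
    \<and> integrable M (\<lambda>x. exp (\<delta> * \<bar>v x\<bar>) * exp_density M p w x)"
proof -
  obtain \<delta> where d: "\<delta> > 0" "\<And>t. \<bar>t\<bar> \<le> \<delta> \<Longrightarrow> (\<lambda>x. w x + t * v x) \<in> KDom_interior M p"
    using KDom_interior_perturb[OF w v] by blast
  note [measurable] = KDom_interiorD(2)[OF w] Bsp_measurable[OF v]
  have "integrable M (\<lambda>x. exp (w x + t * v x) * p x)" if "\<bar>t\<bar> \<le> \<delta>" for t
    using KDom_interiorD(3)[OF d(2)[OF that]] .
  from this[of \<delta>] this[of "- \<delta>"] d(1)
  have "integrable M (\<lambda>x. (exp (w x + \<delta> * v x) + exp (w x - \<delta> * v x)) * p x)"
    by (auto simp: distrib_right)
  then have "integrable M (\<lambda>x. (exp (\<delta> * \<bar>v x\<bar>) * exp (w x)) * p x)"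
  proof (rule integrable_weighted_bound)
    show "\<bar>exp (\<delta> * \<bar>v x\<bar>) * exp (w x)\<bar> \<le> exp (w x + \<delta> * v x) + exp (w x - \<delta> * v x)" for x
      by (cases "v x \<ge> 0") (auto simp: algebra_simps simp flip: exp_add)
  qed auto
  then have "integrable M (\<lambda>x. exp (\<delta> * \<bar>v x\<bar>) * exp_density M p w x)"
    unfolding exp_density_weighted by simp
  with d show ?thesis by blast
qed

lemma Bsp_integrable_exp_density:
  assumes w: "w \<in> KDom_interior M p" and v: "v \<in> Bsp M p"
  shows "integrable M (\<lambda>x. v x * exp_density M p w x)"
proof -
  note [measurable] = exp_density_measurable[OF KDom_interiorD(2)[OF w]] Bsp_measurable[OF v]
  obtain \<delta> where d: "\<delta> > 0" "integrable M (\<lambda>x. exp (\<delta> * \<bar>v x\<bar>) * exp_density M p w x)"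
    using KDom_interior_exp_moment[OF w v] by blast
  have "integrable M (\<lambda>x. (\<delta> * v x) * exp_density M p w x)"
  proof (rule integrable_weighted_bound[OF d(2)])
    show "\<bar>\<delta> * v x\<bar> \<le> exp (\<delta> * \<bar>v x\<bar>)" for x
      using abs_le_exp_abs[of "\<delta> * v x"] d(1) by (simp add: abs_mult)
  qed auto
  then have "integrable M (\<lambda>x. (1/\<delta>) * ((\<delta> * v x) * exp_density M p w x))"
    by (rule integrable_mult_right)
  then show ?thesis using d(1) by simp
qed

section \<open>Moment matching at an m-projection\<close>

text \<open>
  After tilting, \<open>exp (K (w + t v) - K w)\<close> is the expectation of \<open>exp (t v)\<close> under the density of \<open>w\<close>;
  the pointwise second-order bound, integrated, estimates it by \<open>1 + t E[v] + C t\<^sup>2 \<le> exp (t E[v] + C t\<^sup>2)\<close>.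
  Only this upper bound is relevant for a minimiser, because minimality supplies the opposite
  inequality.
\<close>

lemma Kfun_second_order_bound:
  assumes w: "w \<in> KDom_interior M p" and v: "v \<in> Bsp M p"
  shows "\<exists>\<delta>>0. \<exists>C. \<forall>t. \<bar>t\<bar> \<le> \<delta> \<longrightarrow> (\<lambda>x. w x + t * v x) \<in> KDom_interior M p \<and>
    real_of_ereal (Kfun M p (\<lambda>x. w x + t * v x))
      \<le> real_of_ereal (Kfun M p w) + t * expect M (exp_density M p w) v + C * t\<^sup>2"
proof -
  let ?q = "exp_density M p w" and ?K = "real_of_ereal (Kfun M p w)"
  let ?m = "expect M ?q v"
  note [measurable] = KDom_interiorD(2)[OF w] Bsp_measurable[OF v]
    exp_density_measurable[OF KDom_interiorD(2)[OF w]]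
  obtain \<delta> where d: "\<delta> > 0" "\<And>t. \<bar>t\<bar> \<le> \<delta> \<Longrightarrow> (\<lambda>x. w x + t * v x) \<in> KDom_interior M p"
    and J: "integrable M (\<lambda>x. exp (\<delta> * \<bar>v x\<bar>) * ?q x)"
    using KDom_interior_exp_moment[OF w v] by blast
  \<comment> \<open>the scalar bound is applied with \<open>s = t / \<delta>\<close> and \<open>y = \<delta> v\<close>, whence \<open>\<delta>\<^sup>2\<close> here and \<open>\<bar>t\<bar> \<le> \<delta> / 2\<close> below\<close>
  define C where "C = 4 / \<delta>\<^sup>2 * (LINT x|M. exp (\<delta> * \<bar>v x\<bar>) * ?q x)"
  have bound: "real_of_ereal (Kfun M p (\<lambda>x. w x + t * v x)) \<le> ?K + t * ?m + C * t\<^sup>2"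
    if t: "\<bar>t\<bar> \<le> \<delta> / 2" for t
  proof -
    have int: "integrable M (\<lambda>x. exp (w x + t * v x) * p x)"
      using KDom_interiorD(3)[OF d(2)] t d(1) by simp
    have eq: "exp (w x + t * v x) * p x = exp ?K * (exp (t * v x) * ?q x)" for x
      by (simp add: exp_density_def exp_diff exp_add)
    have int': "integrable M (\<lambda>x. exp (t * v x) * ?q x)"
      using int unfolding eq by simp
    have vq: "integrable M (\<lambda>x. v x * ?q x)" by (rule Bsp_integrable_exp_density[OF w v])
    have q1: "integrable M ?q" "(LINT x|M. ?q x) = 1"
      using exp_density_integral[OF KDom_interiorD(3)[OF w]] by auto
    have "(LINT x|M. exp (t * v x) * ?q x)
        \<le> (LINT x|M. ?q x + t * (v x * ?q x) + 4 / \<delta>\<^sup>2 * t\<^sup>2 * (exp (\<delta> * \<bar>v x\<bar>) * ?q x))"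
    proof (rule integral_mono_AE[OF int'])
      show "integrable M (\<lambda>x. ?q x + t * (v x * ?q x)
          + 4 / \<delta>\<^sup>2 * t\<^sup>2 * (exp (\<delta> * \<bar>v x\<bar>) * ?q x))"
        using vq q1(1) J by (intro Bochner_Integration.integrable_add integrable_mult_right)
      show "AE x in M. exp (t * v x) * ?q x
          \<le> ?q x + t * (v x * ?q x) + 4 / \<delta>\<^sup>2 * t\<^sup>2 * (exp (\<delta> * \<bar>v x\<bar>) * ?q x)"
        using exp_density_pos[of w]
      proof eventually_elim
        case (elim x)
        have "exp ((t / \<delta>) * (\<delta> * v x))
            \<le> 1 + (t / \<delta>) * (\<delta> * v x) + 4 * (t / \<delta>)\<^sup>2 * exp \<bar>\<delta> * v x\<bar>"
          using t d(1) by (intro exp_second_order_bound) (simp add: field_simps)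
        then have "exp (t * v x) \<le> 1 + t * v x + 4 / \<delta>\<^sup>2 * t\<^sup>2 * exp (\<delta> * \<bar>v x\<bar>)"
          using d(1) by (simp add: abs_mult power_divide)
        then have "exp (t * v x) * ?q x
            \<le> (1 + t * v x + 4 / \<delta>\<^sup>2 * t\<^sup>2 * exp (\<delta> * \<bar>v x\<bar>)) * ?q x"
          using elim by (intro mult_right_mono) auto
        then show ?case by (simp add: algebra_simps)
      qed
    qed
    also have "\<dots> = 1 + t * ?m + C * t\<^sup>2"
      using vq q1 J by (simp add: C_def expect_def)
    also have "1 + t * ?m + C * t\<^sup>2 \<le> exp (t * ?m + C * t\<^sup>2)"
      using exp_ge_add_one_self[of "t * ?m + C * t\<^sup>2"] by linarith
    finally have le: "(LINT x|M. exp (t * v x) * ?q x) \<le> exp (t * ?m + C * t\<^sup>2)" .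
    have "exp (real_of_ereal (Kfun M p (\<lambda>x. w x + t * v x)))
        = exp ?K * (LINT x|M. exp (t * v x) * ?q x)"
      using exp_Kfun[OF int] unfolding eq by simp
    also have "\<dots> \<le> exp ?K * exp (t * ?m + C * t\<^sup>2)"
      using le by (intro mult_left_mono) auto
    finally show ?thesis by (simp flip: exp_add)
  qed
  show ?thesis
    by (rule exI[of _ "\<delta> / 2"], intro conjI exI[of _ C] allI impI)
      (use d bound in auto)
qed

lemma KL_exp_density:
  assumes w: "w \<in> KDom_interior M p" and z: "z \<in> KDom_interior M p"
  shows "KL M (exp_density M p w) (exp_density M p z)
    = ereal (expect M (exp_density M p w) w - real_of_ereal (Kfun M p w)
        + (real_of_ereal (Kfun M p z) - expect M (exp_density M p w) z))"
proof -
  let ?q = "exp_density M p w" and ?r = "exp_density M p z"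
  let ?k = "real_of_ereal (Kfun M p z) - real_of_ereal (Kfun M p w)"
  note [measurable] = KDom_interiorD(2)[OF w] KDom_interiorD(2)[OF z]
    exp_density_measurable[OF KDom_interiorD(2)[OF w]] exp_density_measurable[OF KDom_interiorD(2)[OF z]]
  have wq: "integrable M (\<lambda>x. w x * ?q x)" "integrable M (\<lambda>x. z x * ?q x)"
    using Bsp_integrable_exp_density[OF w] KDom_interiorD(1)[OF w] KDom_interiorD(1)[OF z] by auto
  have q1: "integrable M ?q" "(LINT x|M. ?q x) = 1"
    using exp_density_integral[OF KDom_interiorD(3)[OF w]] by auto
  have ae: "AE x in M. ?q x * ln (?q x / ?r x) = w x * ?q x - z x * ?q x + ?k * ?q x"
    using p_dens(2)
  proof eventually_elim
    case (elim x)
    then have "?q x / ?r x = exp (w x - z x + ?k)"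
      by (simp add: exp_density_def exp_diff exp_add field_simps)
    then show ?case by (simp add: algebra_simps)
  qed
  have int: "integrable M (\<lambda>x. w x * ?q x - z x * ?q x + ?k * ?q x)"
    using wq q1(1) by auto
  have "integrable M (\<lambda>x. ?q x * ln (?q x / ?r x))"
    by (subst integrable_cong_AE[OF _ _ ae]) (use int in auto)
  moreover have "(LINT x|M. ?q x * ln (?q x / ?r x))
      = (LINT x|M. w x * ?q x - z x * ?q x + ?k * ?q x)"
    by (intro integral_cong_AE ae) auto
  moreover have "\<dots> = expect M ?q w - expect M ?q z + ?k"
    using wq q1 by (simp add: expect_def)
  ultimately show ?thesis by (simp add: KL_def)
qed

context
  fixes u :: "'d::finite \<Rightarrow> 'a \<Rightarrow> real"
  assumes u: "\<And>j. u j \<in> Bsp M p"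
begin

lemma expect_lincomb:
  assumes "w \<in> KDom_interior M p"
  shows "expect M (exp_density M p w) (lincomb u \<theta>)
    = (\<Sum>j\<in>UNIV. \<theta> $ j * expect M (exp_density M p w) (u j))"
proof -
  have "expect M (exp_density M p w) (lincomb u \<theta>)
      = (LINT x|M. (\<Sum>j\<in>UNIV. \<theta> $ j * (u j x * exp_density M p w x)))"
    by (simp add: expect_def lincomb_def sum_distrib_right mult.assoc)
  also have "\<dots> = (\<Sum>j\<in>UNIV. LINT x|M. \<theta> $ j * (u j x * exp_density M p w x))"
    using Bsp_integrable_exp_density[OF assms u] by (intro Bochner_Integration.integral_sum) auto
  finally show ?thesis by (simp add: expect_def)
qed

lemma class_expect_exp_density:
  assumes "w \<in> KDom_interior M p"
  shows "class_expect M (ae_class M (exp_density M p w)) (u j) = expect M (exp_density M p w) (u j)"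
  by (intro class_expect_ae_class exp_density_measurable KDom_interiorD(2)[OF assms] Bsp_measurable[OF u])

text \<open>
  The logarithm of the density ratio is affine in the sufficient statistics \<open>u\<^sub>j\<close>, so integrating it
  against \<open>Q\<close> lets \<open>Q\<close> interact with \<open>\<theta>\<close> only through its moments.
\<close>

lemma class_KL_exp_family:
  assumes Q: "Q \<in> max_exp_model M p"
  shows "\<exists>c. \<forall>\<theta>\<in>nat_params M p u. class_KL M Q (ae_class M (exp_density M p (lincomb u \<theta>)))
    = ereal (c + (real_of_ereal (Kfun M p (lincomb u \<theta>)) - (\<Sum>j\<in>UNIV. \<theta> $ j * class_expect M Q (u j))))"
proof -
  obtain w where w: "w \<in> KDom_interior M p" and Q: "Q = ae_class M (exp_density M p w)"
    using Q by (auto simp: max_exp_model_def)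
  show ?thesis unfolding Q class_expect_exp_density[OF w] expect_lincomb[OF w, symmetric]
  proof (intro exI ballI)
    fix \<theta> assume "\<theta> \<in> nat_params M p u"
    then have z: "lincomb u \<theta> \<in> KDom_interior M p" by (simp add: nat_params_def)
    show "class_KL M (ae_class M (exp_density M p w)) (ae_class M (exp_density M p (lincomb u \<theta>)))
      = ereal (expect M (exp_density M p w) w - real_of_ereal (Kfun M p w)
        + (real_of_ereal (Kfun M p (lincomb u \<theta>)) - expect M (exp_density M p w) (lincomb u \<theta>)))"
      using w z by (simp add: class_KL_ae_class exp_density_measurable KDom_interiorD KL_exp_density)
  qed
qed

text \<open>
  Moving the minimising parameter by \<open>t\<close> in the \<open>j\<close>-th direction cannot decrease the divergence.
  With the second-order bound this gives \<open>t (m - a) \<le> C t\<^sup>2\<close> for all small \<open>t\<close> of either sign, where \<open>m\<close>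
  and \<open>a\<close> are the \<open>j\<close>-th moments of \<open>Q\<close> and of its projection; this forces \<open>m = a\<close>.
\<close>

lemma m_projection_moments:
  assumes Q: "Q \<in> max_exp_model M p" and R: "is_m_projection M p u Q R"
  shows "class_expect M Q (u j) = class_expect M R (u j)"
proof -
  obtain \<theta> where th: "\<theta> \<in> nat_params M p u" and R_eq: "R = ae_class M (exp_density M p (lincomb u \<theta>))"
    and min: "\<And>\<theta>'. \<theta>' \<in> nat_params M p u \<Longrightarrow>
      \<not> class_KL M Q (ae_class M (exp_density M p (lincomb u \<theta>'))) < class_KL M Q R"
    using R unfolding is_m_projection_def is_arg_min_def exp_family_def by blast
  obtain c where c: "\<And>\<theta>. \<theta> \<in> nat_params M p u \<Longrightarrow>
      class_KL M Q (ae_class M (exp_density M p (lincomb u \<theta>)))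
      = ereal (c + (real_of_ereal (Kfun M p (lincomb u \<theta>)) - (\<Sum>j\<in>UNIV. \<theta> $ j * class_expect M Q (u j))))"
    using class_KL_exp_family[OF Q] by blast
  have w: "lincomb u \<theta> \<in> KDom_interior M p" using th by (simp add: nat_params_def)
  let ?K = "\<lambda>w. real_of_ereal (Kfun M p w)"
  let ?m = "class_expect M Q (u j)" and ?a = "expect M (exp_density M p (lincomb u \<theta>)) (u j)"
  obtain \<delta> C where d: "\<delta> > 0" and dC: "\<And>t. \<bar>t\<bar> \<le> \<delta> \<Longrightarrow>
      (\<lambda>x. lincomb u \<theta> x + t * u j x) \<in> KDom_interior M p \<and>
      ?K (\<lambda>x. lincomb u \<theta> x + t * u j x) \<le> ?K (lincomb u \<theta>) + t * ?a + C * t\<^sup>2"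
    using Kfun_second_order_bound[OF w u] by blast
  have key: "t * (?m - ?a) \<le> C * t\<^sup>2" if t: "\<bar>t\<bar> \<le> \<delta>" for t
  proof -
    define \<theta>' where "\<theta>' = \<theta> + t *\<^sub>R axis j 1"
    have th'_nth: "\<theta>' $ i = \<theta> $ i + (if i = j then t else 0)" for i
      by (simp add: \<theta>'_def axis_def)
    have sum': "(\<Sum>i\<in>UNIV. \<theta>' $ i * f i) = (\<Sum>i\<in>UNIV. \<theta> $ i * f i) + t * f j" for f :: "'d \<Rightarrow> real"
      by (simp add: th'_nth distrib_right sum.distrib if_distrib[of "\<lambda>y. y * _"] cong: if_cong)
    have lin: "lincomb u \<theta>' = (\<lambda>x. lincomb u \<theta> x + t * u j x)"
      by (simp add: lincomb_def fun_eq_iff sum')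
    have th': "\<theta>' \<in> nat_params M p u" using dC[OF t] by (simp add: nat_params_def lin)
    have "?K (lincomb u \<theta>) \<le> ?K (lincomb u \<theta>') - t * ?m"
      using min[OF th'] unfolding R_eq c[OF th] c[OF th'] sum' by simp
    with dC[OF t] show ?thesis unfolding lin by (simp add: right_diff_distrib)
  qed
  have "?m = ?a"
  proof (rule ccontr)
    assume "?m \<noteq> ?a"
    define e where "e = \<bar>?m - ?a\<bar>"
    have e: "e > 0" using \<open>?m \<noteq> ?a\<close> by (simp add: e_def)
    \<comment> \<open>a step \<open>s\<close> so short that the quadratic term \<open>C s\<^sup>2\<close> is smaller than \<open>s e\<close>\<close>
    define s where "s = min \<delta> (e / (2 * (\<bar>C\<bar> + 1)))"
    have s: "s > 0" "s \<le> \<delta>" "s \<le> e / (2 * (\<bar>C\<bar> + 1))"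
      using d e by (auto simp: s_def)
    have "s * e \<le> C * s\<^sup>2"
      using key[of s] key[of "- s"] s by (cases "?m \<ge> ?a") (auto simp: e_def algebra_simps)
    then have "s * e \<le> s * (C * s)" by (simp add: power2_eq_square mult_ac)
    then have "e \<le> C * s" using s(1) by simp
    also have "\<dots> \<le> \<bar>C\<bar> * s" using s(1) by (intro mult_right_mono) auto
    also have "\<dots> < (2 * (\<bar>C\<bar> + 1)) * s" using s(1) by (intro mult_strict_right_mono) auto
    also have "\<dots> \<le> e" using s(3) by (simp add: pos_le_divide_eq mult.commute)
    finally show False by simp
  qed
  then show ?thesis unfolding R_eq class_expect_exp_density[OF w] .
qed

text \<open>
  The two objective functions differ by a constant on the exponential family, so they have the same
  minimisers; as \<open>m_projection\<close> is a choice among the minimisers, equal sets of minimisers give equal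
  projections.
\<close>

lemma m_projection_cong_moments:
  assumes Q: "Q1 \<in> max_exp_model M p" "Q2 \<in> max_exp_model M p"
    and eq: "\<And>j. class_expect M Q1 (u j) = class_expect M Q2 (u j)"
  shows "m_projection M p u Q1 = m_projection M p u Q2"
proof -
  obtain c1 where c1: "\<And>\<theta>. \<theta> \<in> nat_params M p u \<Longrightarrow>
      class_KL M Q1 (ae_class M (exp_density M p (lincomb u \<theta>)))
      = ereal (c1 + (real_of_ereal (Kfun M p (lincomb u \<theta>)) - (\<Sum>j\<in>UNIV. \<theta> $ j * class_expect M Q1 (u j))))"
    using class_KL_exp_family[OF Q(1)] by blast
  obtain c2 where c2: "\<And>\<theta>. \<theta> \<in> nat_params M p u \<Longrightarrow>
      class_KL M Q2 (ae_class M (exp_density M p (lincomb u \<theta>)))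
      = ereal (c2 + (real_of_ereal (Kfun M p (lincomb u \<theta>)) - (\<Sum>j\<in>UNIV. \<theta> $ j * class_expect M Q2 (u j))))"
    using class_KL_exp_family[OF Q(2)] by blast
  have "\<exists>r. class_KL M Q1 R = ereal (c1 + r) \<and> class_KL M Q2 R = ereal (c2 + r)"
    if "R \<in> exp_family M p u" for R
    using that c1 c2 eq by (auto simp: exp_family_def)
  then have "class_KL M Q1 R < class_KL M Q1 S \<longleftrightarrow> class_KL M Q2 R < class_KL M Q2 S"
    if "R \<in> exp_family M p u" "S \<in> exp_family M p u" for R S
    using that by (metis add_less_cancel_left less_ereal.simps(1))
  then have "is_arg_min (class_KL M Q1) (\<lambda>R. R \<in> exp_family M p u)
      = is_arg_min (class_KL M Q2) (\<lambda>R. R \<in> exp_family M p u)"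
    by (auto simp: is_arg_min_def fun_eq_iff)
  then show ?thesis by (simp add: m_projection_def arg_min_on_def arg_min_def)
qed

end

end

section \<open>Distinct densities with the same moments\<close>

lemma Bsp_infinite_dim_independent:
  assumes "Bsp_infinite_dim M p"
  shows "\<exists>F. finite F \<and> card F = n \<and> F \<subseteq> Bsp M p \<and>
    (\<forall>c :: ('a \<Rightarrow> real) \<Rightarrow> real. (AE x in M. (\<Sum>f\<in>F. c f * f x) = 0) \<longrightarrow> (\<forall>f\<in>F. c f = 0))"
proof (induction n)
  case 0
  show ?case by (rule exI[of _ "{}"]) simp
next
  case (Suc n)
  then obtain F where F: "finite F" "card F = n" "F \<subseteq> Bsp M p"
    and ind: "\<And>c :: ('a \<Rightarrow> real) \<Rightarrow> real. (AE x in M. (\<Sum>f\<in>F. c f * f x) = 0) \<Longrightarrow> \<forall>f\<in>F. c f = 0"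
    by blast
  have "\<not> (\<forall>g\<in>Bsp M p. \<exists>c :: ('a \<Rightarrow> real) \<Rightarrow> real. AE x in M. g x = (\<Sum>f\<in>F. c f * f x))"
    (is "\<not> ?spanned")
  proof
    assume ?spanned
    with F(1,3) have "finite F \<and> F \<subseteq> Bsp M p \<and> ?spanned" by (intro conjI)
    then have "\<not> Bsp_infinite_dim M p" unfolding Bsp_infinite_dim_def not_not by (rule exI)
    with assms show False by simp
  qed
  then obtain g where g: "g \<in> Bsp M p"
    and ng: "\<And>c :: ('a \<Rightarrow> real) \<Rightarrow> real. \<not> (AE x in M. g x = (\<Sum>f\<in>F. c f * f x))"
    by auto
  have "g \<notin> F"
  proof
    assume "g \<in> F"
    have "(\<Sum>f\<in>F. (if f = g then 1 else 0) * f x) = g x" for x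
      using F(1) \<open>g \<in> F\<close> by (simp add: if_distrib[of "\<lambda>y. y * _"] cong: if_cong)
    then show False using ng[of "\<lambda>f. if f = g then 1 else 0"] by simp
  qed
  have "\<forall>f\<in>insert g F. c f = 0"
    if c: "AE x in M. (\<Sum>f\<in>insert g F. c f * f x) = 0" for c :: "('a \<Rightarrow> real) \<Rightarrow> real"
  proof -
    have c': "AE x in M. c g * g x + (\<Sum>f\<in>F. c f * f x) = 0"
      using c F(1) \<open>g \<notin> F\<close> by simp
    have "c g = 0"
    proof (rule ccontr)
      assume "c g \<noteq> 0"
      from c' have "AE x in M. g x = (\<Sum>f\<in>F. (- c f / c g) * f x)"
      proof eventually_elim
        case (elim x)
        have "(\<Sum>f\<in>F. (- c f / c g) * f x) = - (\<Sum>f\<in>F. c f * f x) / c g"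
          by (simp add: sum_divide_distrib sum_negf)
        then have "(\<Sum>f\<in>F. (- c f / c g) * f x) * c g = - (\<Sum>f\<in>F. c f * f x)"
          using \<open>c g \<noteq> 0\<close> by simp
        moreover have "g x * c g = - (\<Sum>f\<in>F. c f * f x)"
          using elim by (simp add: mult.commute eq_neg_iff_add_eq_0)
        ultimately show ?case using \<open>c g \<noteq> 0\<close> by (metis mult_right_cancel)
      qed
      then show False using ng[of "\<lambda>f. - c f / c g"] by contradiction
    qed
    then show ?thesis using c' ind[of c] by simp
  qed
  then show ?case using F g \<open>g \<notin> F\<close> by (intro exI[of _ "insert g F"]) auto
qed

lemma exists_nontrivial_relation:
  fixes g :: "'b \<Rightarrow> 'v::euclidean_space"
  assumes "finite F" "card F > DIM('v)"
  shows "\<exists>c :: 'b \<Rightarrow> real. (\<exists>f\<in>F. c f \<noteq> 0) \<and> (\<Sum>f\<in>F. c f *\<^sub>R g f) = 0"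
proof (cases "inj_on g F")
  case True
  then have "dependent (g ` F)"
    using assms by (intro dependent_biggerset) (simp add: card_image)
  then obtain k where k: "\<exists>v\<in>g ` F. k v \<noteq> 0" "(\<Sum>v\<in>g ` F. k v *\<^sub>R v) = 0"
    using dependent_finite[of "g ` F"] assms(1) by blast
  then show ?thesis using True by (intro exI[of _ "k \<circ> g"]) (auto simp: sum.reindex)
next
  \<comment> \<open>a repeated value is invisible to linear dependence of the image set and gives the relation directly\<close>
  case False
  then obtain a b where ab: "a \<in> F" "b \<in> F" "a \<noteq> b" "g a = g b" by (auto simp: inj_on_def)
  let ?c = "\<lambda>f. if f = a then 1 else if f = b then -1 else (0::real)"
  have "(\<Sum>f\<in>F. ?c f *\<^sub>R g f) = (\<Sum>f\<in>{a, b}. ?c f *\<^sub>R g f)"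
    using ab assms(1) by (intro sum.mono_neutral_right) auto
  also have "\<dots> = 0" using ab by simp
  finally show ?thesis using ab by (intro exI[of _ ?c]) auto
qed

text \<open>
  Dividing elements of \<open>B\<^sub>p\<close> by the common positive weight \<open>1 + \<Sum> \<bar>f\<bar>\<close> makes them bounded without
  affecting linear independence. Among \<open>d + 2\<close> independent functions treated in this way, \<open>d + 1\<close>
  linear conditions leave a nontrivial combination.
\<close>

lemma exists_bounded_orthogonal:
  fixes u :: "'d::finite \<Rightarrow> 'a \<Rightarrow> real"
  assumes p: "p \<in> densities M" and u: "\<And>j. u j \<in> Bsp M p" and inf: "Bsp_infinite_dim M p"
  obtains b where "b \<in> borel_measurable M" "\<And>x. \<bar>b x\<bar> \<le> 1/2" "\<not> (AE x in M. b x = 0)"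
    "expect M p b = 0" "\<And>j. expect M p (\<lambda>x. b x * u j x) = 0"
proof -
  obtain F where F: "finite F" "card F = Suc (DIM(real \<times> (real ^ 'd)))" "F \<subseteq> Bsp M p"
    and ind: "\<And>c :: ('a \<Rightarrow> real) \<Rightarrow> real. (AE x in M. (\<Sum>f\<in>F. c f * f x) = 0) \<Longrightarrow> \<forall>f\<in>F. c f = 0"
    using Bsp_infinite_dim_independent[OF inf] by blast
  have [measurable]: "u j \<in> borel_measurable M" "p \<in> borel_measurable M" for j
    using Bsp_measurable[OF p u] densitiesD(1)[OF p] by auto
  have Fm [measurable]: "f \<in> borel_measurable M" if "f \<in> F" for f
    using that F(3) Bsp_measurable[OF p] by blast
  define D where "D = (\<lambda>x. 1 + (\<Sum>f\<in>F. \<bar>f x\<bar>))"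
  have Dm [measurable]: "D \<in> borel_measurable M" unfolding D_def by measurable
  have D1: "D x \<ge> 1" for x by (simp add: D_def sum_nonneg)
  have D: "D x > 0" for x using D1[of x] by linarith
  have fD: "\<bar>f x / D x\<bar> \<le> 1" if "f \<in> F" for f x
  proof -
    have "\<bar>f x\<bar> \<le> (\<Sum>f\<in>F. \<bar>f x\<bar>)" using F(1) that by (intro member_le_sum) auto
    then show ?thesis using D[of x] by (simp add: abs_divide) (simp add: D_def)
  qed
  have i1: "integrable M (\<lambda>x. f x / D x * p x)" if "f \<in> F" for f
    using fD[OF that] Fm[OF that] by (intro integrable_bounded_weighted[OF p, of _ 1]) auto
  have i2: "integrable M (\<lambda>x. f x / D x * u j x * p x)" if "f \<in> F" for f j
    using fD[OF that] Fm[OF that] by (intro integrable_bounded_mult_Bsp[OF p _ _ u]) auto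
  \<comment> \<open>the linear conditions on \<open>f / D\<close>: orthogonality to \<open>1\<close> and to each \<open>u\<^sub>j\<close>\<close>
  define g :: "('a \<Rightarrow> real) \<Rightarrow> real \<times> (real ^ 'd)" where
    "g f = (LINT x|M. f x / D x * p x, \<chi> j. LINT x|M. f x / D x * u j x * p x)" for f
  obtain c :: "('a \<Rightarrow> real) \<Rightarrow> real" where c: "\<exists>f\<in>F. c f \<noteq> 0" and c0: "(\<Sum>f\<in>F. c f *\<^sub>R g f) = 0"
    using exists_nontrivial_relation[OF F(1), of g] F(2) by auto
  have g1: "(\<Sum>f\<in>F. c f * (LINT x|M. f x / D x * p x)) = 0"
    using arg_cong[OF c0, of fst] by (simp add: g_def fst_sum)
  have g2: "(\<Sum>f\<in>F. c f * (LINT x|M. f x / D x * u j x * p x)) = 0" for j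
    using arg_cong[OF c0, of "\<lambda>y. snd y $ j"] by (simp add: g_def snd_sum)
  \<comment> \<open>divisor that brings the combination below the bound \<open>1/2\<close>\<close>
  define A where "A = 2 * (1 + (\<Sum>f\<in>F. \<bar>c f\<bar>))"
  have A: "A > 0" by (simp add: A_def add_pos_nonneg sum_nonneg)
  define b where "b = (\<lambda>x. (\<Sum>f\<in>F. c f * (f x / D x)) / A)"
  show thesis
  proof
    show "b \<in> borel_measurable M" unfolding b_def by measurable
    show "\<bar>b x\<bar> \<le> 1/2" for x
    proof -
      have "\<bar>\<Sum>f\<in>F. c f * (f x / D x)\<bar> \<le> (\<Sum>f\<in>F. \<bar>c f * (f x / D x)\<bar>)" by (rule sum_abs)
      also have "\<dots> \<le> (\<Sum>f\<in>F. \<bar>c f\<bar>)"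
      proof (rule sum_mono)
        fix f assume "f \<in> F"
        then have "\<bar>c f\<bar> * \<bar>f x / D x\<bar> \<le> \<bar>c f\<bar> * 1" using fD by (intro mult_left_mono) auto
        then show "\<bar>c f * (f x / D x)\<bar> \<le> \<bar>c f\<bar>" unfolding abs_mult by simp
      qed
      also have "\<dots> \<le> 1/2 * A" by (simp add: A_def)
      finally show ?thesis using A by (simp add: b_def abs_divide divide_le_eq)
    qed
    show "\<not> (AE x in M. b x = 0)"
    proof
      assume "AE x in M. b x = 0"
      then have "AE x in M. (\<Sum>f\<in>F. c f * f x) = 0"
      proof eventually_elim
        case (elim x)
        have "b x = (\<Sum>f\<in>F. c f * f x) / D x / A"
          by (simp add: b_def sum_divide_distrib)
        then show ?case using elim A D[of x] by simp
      qed
      then show False using ind[of c] c by blast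
    qed
    have "expect M p b = (LINT x|M. (\<Sum>f\<in>F. c f * (f x / D x * p x)) / A)"
      by (simp add: expect_def b_def sum_distrib_right mult.assoc)
    also have "\<dots> = (\<Sum>f\<in>F. LINT x|M. c f * (f x / D x * p x)) / A"
      unfolding integral_divide_zero
      by (subst Bochner_Integration.integral_sum) (auto simp only: intro!: integrable_mult_right i1)
    also have "\<dots> = 0" using g1 by (simp only: integral_mult_right_zero div_0)
    finally show "expect M p b = 0" .
    show "expect M p (\<lambda>x. b x * u j x) = 0" for j
    proof -
      have "expect M p (\<lambda>x. b x * u j x) = (LINT x|M. (\<Sum>f\<in>F. c f * (f x / D x * u j x * p x)) / A)"
        by (simp add: expect_def b_def sum_distrib_right mult.assoc)
      also have "\<dots> = (\<Sum>f\<in>F. LINT x|M. c f * (f x / D x * u j x * p x)) / A"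
        unfolding integral_divide_zero
        by (subst Bochner_Integration.integral_sum) (auto simp only: intro!: integrable_mult_right i2)
      also have "\<dots> = 0" using g2 by (simp only: integral_mult_right_zero div_0)
      finally show ?thesis .
    qed
  qed
qed

text \<open>
  The centred variable \<open>w = ln (1 + b) - E\<^sub>p[ln (1 + b)]\<close> is bounded, hence interior, and its cumulant
  \<open>K w\<close> cancels the centring constant, so that its density is exactly \<open>(1 + b) p\<close>.
\<close>

lemma bounded_perturbation_in_max_exp_model:
  assumes p: "p \<in> densities M" and [measurable]: "b \<in> borel_measurable M"
    and b: "\<And>x. \<bar>b x\<bar> \<le> 1/2" and b0: "expect M p b = 0"
  shows "ae_class M (\<lambda>x. (1 + b x) * p x) \<in> max_exp_model M p"
proof -
  note [measurable] = densitiesD(1)[OF p]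
  have pos: "1/2 \<le> 1 + b x" "1 + b x \<le> 2" for x using b[of x] by (auto simp: abs_le_iff)
  have gt: "1 + b x > 0" for x using pos(1)[of x] by linarith
  define m where "m = expect M p (\<lambda>x. ln (1 + b x))"
  define w where "w = (\<lambda>x. ln (1 + b x) - m)"
  have wm [measurable]: "w \<in> borel_measurable M" unfolding w_def by measurable
  have lnb: "\<bar>ln (1 + b x)\<bar> \<le> ln 2" for x
  proof -
    have "ln (1 + b x) \<le> ln 2" using pos(2)[of x] gt[of x] by simp
    moreover have "ln (1/2) \<le> ln (1 + b x)" using pos(1)[of x] by (subst ln_le_cancel_iff) auto
    ultimately show ?thesis by (simp add: ln_div abs_le_iff)
  qed
  have i: "integrable M (\<lambda>x. ln (1 + b x) * p x)"
    using lnb by (intro integrable_bounded_weighted[OF p, of _ "ln 2"]) auto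
  have ib: "integrable M (\<lambda>x. b x * p x)"
    using b by (intro integrable_bounded_weighted[OF p, of _ "1/2"]) auto
  have w0: "expect M p w = 0"
    using i densitiesD(4,5)[OF p] by (simp add: expect_def w_def left_diff_distrib m_def)
  have w: "w \<in> KDom_interior M p"
  proof (rule bounded_in_KDom_interior[OF p wm _ w0])
    show "\<bar>w x\<bar> \<le> ln 2 + \<bar>m\<bar>" for x using lnb[of x] unfolding w_def by linarith
  qed
  have ew: "exp (w x) * p x = exp (- m) * (p x + b x * p x)" for x
    using gt[of x] by (simp add: w_def exp_diff exp_minus field_simps)
  have "exp (real_of_ereal (Kfun M p w)) = exp (- m)"
    using exp_Kfun[OF p KDom_interiorD(3)[OF p w]] ib b0 densitiesD(4,5)[OF p]
    by (simp add: ew expect_def)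
  then have "real_of_ereal (Kfun M p w) = - m" by simp
  then have "exp_density M p w = (\<lambda>x. (1 + b x) * p x)"
    using gt by (simp add: exp_density_def w_def fun_eq_iff)
  then have "ae_class M (\<lambda>x. (1 + b x) * p x) = ae_class M (exp_density M p w)" by simp
  then show ?thesis using w unfolding max_exp_model_def by blast
qed

section \<open>The projection distance is a degenerate pseudo-metric\<close>

lemma exists_distinct_equal_moments:
  fixes u :: "'d::finite \<Rightarrow> 'a \<Rightarrow> real"
  assumes p: "p \<in> densities M" and u: "\<And>j. u j \<in> Bsp M p" and inf: "Bsp_infinite_dim M p"
  shows "\<exists>Q1\<in>max_exp_model M p. \<exists>Q2\<in>max_exp_model M p.
    Q1 \<noteq> Q2 \<and> (\<forall>j. class_expect M Q1 (u j) = class_expect M Q2 (u j))"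
proof -
  obtain b where b [measurable]: "b \<in> borel_measurable M" and b12: "\<And>x. \<bar>b x\<bar> \<le> 1/2"
    and nz: "\<not> (AE x in M. b x = 0)" and b0: "expect M p b = 0"
    and bu: "\<And>j. expect M p (\<lambda>x. b x * u j x) = 0"
    using exists_bounded_orthogonal[where u = u, OF p u inf] by blast
  have [measurable]: "u j \<in> borel_measurable M" "p \<in> borel_measurable M" for j
    using Bsp_measurable[OF p u] densitiesD(1)[OF p] by auto
  \<comment> \<open>\<open>p\<close> itself is the perturbation by \<open>0\<close>, so one membership lemma serves both points\<close>
  let ?Q = "ae_class M (\<lambda>x. (1 + b x) * p x)" and ?P = "ae_class M (\<lambda>x. (1 + 0) * p x)"
  have "?P \<noteq> ?Q"
  proof
    assume "?P = ?Q"
    then have "AE x in M. (1 + 0) * p x = (1 + b x) * p x"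
      by (subst (asm) ae_class_eq_iff) auto
    then have "AE x in M. b x = 0"
      using densitiesD(2)[OF p] by eventually_elim (auto simp: distrib_right)
    then show False using nz by blast
  qed
  moreover have "?P \<in> max_exp_model M p"
    by (rule bounded_perturbation_in_max_exp_model[OF p]) (auto simp: expect_def)
  moreover have "?Q \<in> max_exp_model M p"
    by (rule bounded_perturbation_in_max_exp_model[OF p b b12 b0])
  moreover have "class_expect M ?P (u j) = class_expect M ?Q (u j)" for j
  proof -
    have ub: "integrable M (\<lambda>x. b x * u j x * p x)"
      by (rule integrable_bounded_mult_Bsp[OF p b b12 u])
    have "class_expect M ?Q (u j) = (LINT x|M. u j x * p x + b x * u j x * p x)"
      by (subst class_expect_ae_class) (auto simp: expect_def algebra_simps)
    also have "\<dots> = expect M p (u j) + expect M p (\<lambda>x. b x * u j x)"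
      using Bsp_integrable[OF p u[of j]] ub by (simp add: expect_def)
    also have "\<dots> = class_expect M ?P (u j)"
      using bu[of j] by (simp add: class_expect_ae_class)
    finally show ?thesis by simp
  qed
  ultimately show ?thesis by blast
qed

theorem proposition4p9:
  fixes M :: "'a measure"
    and p :: "'a \<Rightarrow> real"
    and u :: "'d::finite \<Rightarrow> 'a \<Rightarrow> real"
    and \<rho> :: "('a \<Rightarrow> real) set \<Rightarrow> ('a \<Rightarrow> real) set \<Rightarrow> real"
  assumes "sigma_finite_measure M"
    and "p \<in> densities M"
    and "\<And>j. u j \<in> Bsp M p"
    and "L2_lin_indep M p u"
    and "Bsp_infinite_dim M p"
    and "\<And>q. q \<in> max_exp_model M p \<Longrightarrow> \<exists>r. is_m_projection M p u q r"
    and "Metric_space (exp_family M p u) \<rho>"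
  shows
    "(\<forall>q1 \<in> max_exp_model M p. \<forall>q2 \<in> max_exp_model M p. proj_dist M p u \<rho> q1 q2 \<ge> 0) \<and>
     (\<forall>q1 \<in> max_exp_model M p. \<forall>q2 \<in> max_exp_model M p. proj_dist M p u \<rho> q1 q2 = proj_dist M p u \<rho> q2 q1) \<and>
     (\<forall>q1 \<in> max_exp_model M p. \<forall>q2 \<in> max_exp_model M p. \<forall>q3 \<in> max_exp_model M p.
        proj_dist M p u \<rho> q1 q3 \<le> proj_dist M p u \<rho> q1 q2 + proj_dist M p u \<rho> q2 q3) \<and>
     (\<forall>q1 \<in> max_exp_model M p. \<forall>q2 \<in> max_exp_model M p.
        proj_dist M p u \<rho> q1 q2 = 0 \<longleftrightarrow> (\<forall>j. class_expect M q1 (u j) = class_expect M q2 (u j))) \<and>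
     (\<forall>q \<in> max_exp_model M p. proj_dist M p u \<rho> q q = 0) \<and>
     (\<exists>q1 \<in> max_exp_model M p. \<exists>q2 \<in> max_exp_model M p. proj_dist M p u \<rho> q1 q2 = 0 \<and> q1 \<noteq> q2)"
proof -
  interpret N: Metric_space "exp_family M p u" \<rho> by fact
  have proj: "is_m_projection M p u q (m_projection M p u q)" if "q \<in> max_exp_model M p" for q
    using someI_ex[OF assms(6)[OF that]]
    by (simp add: is_m_projection_def m_projection_def arg_min_on_def arg_min_def)
  then have mem: "m_projection M p u q \<in> exp_family M p u" if "q \<in> max_exp_model M p" for q
    using that by (simp add: is_m_projection_def is_arg_min_def)
  have zero: "proj_dist M p u \<rho> q1 q2 = 0 \<longleftrightarrow> (\<forall>j. class_expect M q1 (u j) = class_expect M q2 (u j))"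
    if q: "q1 \<in> max_exp_model M p" "q2 \<in> max_exp_model M p" for q1 q2
  proof -
    have "proj_dist M p u \<rho> q1 q2 = 0 \<longleftrightarrow> m_projection M p u q1 = m_projection M p u q2"
      using mem q by (simp add: proj_dist_def)
    also have "\<dots> \<longleftrightarrow> (\<forall>j. class_expect M q1 (u j) = class_expect M q2 (u j))"
      using m_projection_moments[where u = u, OF assms(2) assms(3) q(1) proj[OF q(1)]]
        m_projection_moments[where u = u, OF assms(2) assms(3) q(2) proj[OF q(2)]]
        m_projection_cong_moments[where u = u, OF assms(2) assms(3) q] by metis
    finally show ?thesis .
  qed
  have "\<exists>q1 \<in> max_exp_model M p. \<exists>q2 \<in> max_exp_model M p. proj_dist M p u \<rho> q1 q2 = 0 \<and> q1 \<noteq> q2"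
    using exists_distinct_equal_moments[where u = u, OF assms(2) assms(3) assms(5)] zero by blast
  moreover have "proj_dist M p u \<rho> q1 q2 = proj_dist M p u \<rho> q2 q1" for q1 q2
    unfolding proj_dist_def by (rule N.commute)
  moreover have "proj_dist M p u \<rho> q1 q3 \<le> proj_dist M p u \<rho> q1 q2 + proj_dist M p u \<rho> q2 q3"
    if "q1 \<in> max_exp_model M p" "q2 \<in> max_exp_model M p" "q3 \<in> max_exp_model M p" for q1 q2 q3
    unfolding proj_dist_def using that by (intro N.triangle mem)
  moreover have "proj_dist M p u \<rho> q1 q2 \<ge> 0" for q1 q2
    by (simp add: proj_dist_def)
  moreover have "proj_dist M p u \<rho> q q = 0" if "q \<in> max_exp_model M p" for q
    using zero[OF that that] by simp
  ultimately show ?thesis using zero by (intro conjI ballI) auto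
qed

end
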